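(* Let $n$ be an even positive integer, let $T$ be an even plane tree with $n$ vertices and let $U$ be an odd plane tree with $n$ vertices. Then the rotation groups of $T$ and $U$ are different: for any choice of bipartite structures on $T$ and $U$ and any enumerations of their edges by $1,\dots,n-1$, the subgroups $R(T)$ and $R(U)$ of $S_{n-1}$ do not coincide.
   Context: A plane tree is a finite tree embedded in the plane (equivalently, a tree with a cyclic counterclockwise order on the edges at each vertex). Parity: a pr-tree (plane rooted tree) is obtained from a plane tree by choosing a root vertex and a marked edge incident to the root. The children of each vertex are ordered from left to right: at the root, the edges are taken in counterclockwise order starting from the marked edge, and at any other vertex the edges to children are taken in counterclockwise order starting just after the edge to the parent. The bracket code of a pr-tree whose root has pr-subtrees $T_1,\dots,T_s$ (left to right) is recursively $(\,c(T_1)\cdots c(T_s)\,)$, where $c(T_i)$ is the code of $T_i$, and the one-vertex tree has code $()$. An inversion in a bracket code is a pair consisting of a closing bracket and an opening bracket, not necessarily adjacent, such that the closing bracket occurs before the opening bracket. A pr-tree is even if the number of inversions in its bracket code is even, and odd otherwise. For a plane tree with an even number of vertices this parity does not depend on the choice of root vertex and marked edge, so one speaks of even and odd plane trees. Rotation group: a bipartite structure on a tree is a coloring of its vertices in black and white such that adjacent vertices have different colors (there are two of them). Let $T$ be a plane bipartite tree with $m$ edges enumerated by $M=\{1,\dots,m\}$. The permutation $s_w:M\to M$ is defined by $s_w(i)=j$ if the $i$-th and $j$-th edges are incident to the same white vertex $v$ and the $j$-th edge is the next after the $i$-th edge in going counterclockwise around $v$ (so $s_w(i)=i$ if $v$ has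 degree 1). The permutation $s_b$ is defined in the same way with respect to black vertices. The rotation group is $R(T)=\langle s_w,s_b\rangle\subset S_m$. Different enumerations of the edges give conjugate rotation groups. *)

theory Defs
  imports "HOL-Algebra.Sym_Groups" "HOL-Combinatorics.Orbits"
begin

section \<open>Plane trees\<close>

text \<open>
  Edges are two-element sets of vertices. For an edge \<open>e\<close> at \<open>v\<close>, \<open>ccw T v e\<close> is the edge
  following \<open>e\<close> in the counterclockwise order around \<open>v\<close>; other values of \<open>ccw\<close> are irrelevant.
\<close>

record 'v plane_graph =
  verts :: "'v set"
  edges :: "'v set set"
  ccw :: "'v \<Rightarrow> 'v set \<Rightarrow> 'v set"

definition incident :: "('v, 'm) plane_graph_scheme \<Rightarrow> 'v \<Rightarrow> 'v set set" where
  "incident T v = {e \<in> edges T. v \<in> e}"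

definition deg :: "('v, 'm) plane_graph_scheme \<Rightarrow> 'v \<Rightarrow> nat" where
  "deg T v = card (incident T v)"

definition is_cycle :: "'v set set \<Rightarrow> 'v list \<Rightarrow> bool" where
  "is_cycle E vs \<longleftrightarrow> 3 \<le> length vs \<and> distinct vs \<and>
     (\<forall>i < length vs. {vs ! i, vs ! (Suc i mod length vs)} \<in> E)"

definition is_tree :: "'v set \<Rightarrow> 'v set set \<Rightarrow> bool" where
  "is_tree V E \<longleftrightarrow>
     finite V \<and> V \<noteq> {} \<and>
     (\<forall>e \<in> E. \<exists>u \<in> V. \<exists>v \<in> V. u \<noteq> v \<and> e = {u, v}) \<and>
     (\<forall>u \<in> V. \<forall>v \<in> V. (u, v) \<in> {(x, y). {x, y} \<in> E}\<^sup>*) \<and>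
     (\<nexists>vs. is_cycle E vs)"

text \<open>
  A cyclic order on a finite set is given by its successor function. The exception for an empty
  set of incident edges (needed only for the one-vertex tree) is due to \<open>cyclic_on f {}\<close> being
  false.
\<close>

definition plane_tree :: "('v, 'm) plane_graph_scheme \<Rightarrow> bool" where
  "plane_tree T \<longleftrightarrow>
     is_tree (verts T) (edges T) \<and>
     (\<forall>v \<in> verts T. incident T v \<noteq> {} \<longrightarrow> cyclic_on (ccw T v) (incident T v))"


section \<open>Parity\<close>

datatype pr_tree = PR_Node "pr_tree list"

datatype bracket = Opening | Closing

fun bracket_code :: "pr_tree \<Rightarrow> bracket list" where
  "bracket_code (PR_Node ts) = Opening # concat (map bracket_code ts) @ [Closing]"

definition inversions :: "bracket list \<Rightarrow> (nat \<times> nat) set" where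
  "inversions w = {(i, j). i < j \<and> j < length w \<and> w ! i = Closing \<and> w ! j = Opening}"

definition even_pr_tree :: "pr_tree \<Rightarrow> bool" where
  "even_pr_tree t \<longleftrightarrow> even (card (inversions (bracket_code t)))"

definition other_end :: "'v set \<Rightarrow> 'v \<Rightarrow> 'v" where
  "other_end e v = (THE u. u \<in> e - {v})"

text \<open>
  \<open>pr_branch T v es t\<close>: reading \<open>T\<close> from the vertex \<open>v\<close>, with \<open>es\<close> the edges from \<open>v\<close> to its
  children from left to right, gives the pr-tree \<open>t\<close>. At the child \<open>other_end e v\<close> the edges are
  listed starting just after the edge \<open>e\<close> to the parent, and \<open>e\<close> itself (exponent 0) is omitted.
\<close>

inductive pr_branch ::
  "('v, 'm) plane_graph_scheme \<Rightarrow> 'v \<Rightarrow> 'v set list \<Rightarrow> pr_tree \<Rightarrow> bool" for T where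
  "list_all2
     (\<lambda>e t. pr_branch T (other_end e v)
        (map (\<lambda>k. (ccw T (other_end e v) ^^ k) e) [1..<deg T (other_end e v)]) t)
     es ts
   \<Longrightarrow> pr_branch T v es (PR_Node ts)"

text \<open>The pr-tree obtained from \<open>T\<close> by choosing the root \<open>r\<close> and the marked edge \<open>e\<close> at \<open>r\<close>.\<close>

definition pr_tree_of :: "('v, 'm) plane_graph_scheme \<Rightarrow> 'v \<Rightarrow> 'v set \<Rightarrow> pr_tree \<Rightarrow> bool" where
  "pr_tree_of T r e t \<longleftrightarrow>
     r \<in> verts T \<and> e \<in> incident T r \<and>
     pr_branch T r (map (\<lambda>k. (ccw T r ^^ k) e) [0..<deg T r]) t"

text \<open>
  For an even number of vertices the parity does not depend on the root and the marked edge, so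
  it is read off some choice of them. For an odd number of vertices a plane tree may satisfy both
  predicates.
\<close>

definition even_plane_tree :: "('v, 'm) plane_graph_scheme \<Rightarrow> bool" where
  "even_plane_tree T \<longleftrightarrow> plane_tree T \<and> (\<exists>r e t. pr_tree_of T r e t \<and> even_pr_tree t)"

definition odd_plane_tree :: "('v, 'm) plane_graph_scheme \<Rightarrow> bool" where
  "odd_plane_tree T \<longleftrightarrow> plane_tree T \<and> (\<exists>r e t. pr_tree_of T r e t \<and> \<not> even_pr_tree t)"


section \<open>Rotation groups\<close>

datatype color = Black | White

definition bipartite_structure :: "('v, 'm) plane_graph_scheme \<Rightarrow> ('v \<Rightarrow> color) \<Rightarrow> bool" where
  "bipartite_structure T col \<longleftrightarrow> (\<forall>u v. {u, v} \<in> edges T \<longrightarrow> col u \<noteq> col v)"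

text \<open>
  The edges are enumerated by a bijection \<open>en\<close> from \<open>{1..m}\<close> onto \<open>edges T\<close>. The permutations are
  extended by the identity outside \<open>{1..m}\<close>, as in \<^const>\<open>sym_group\<close>.
\<close>

definition color_rotation ::
  "('v, 'm) plane_graph_scheme \<Rightarrow> ('v \<Rightarrow> color) \<Rightarrow> (nat \<Rightarrow> 'v set) \<Rightarrow> color \<Rightarrow> nat \<Rightarrow> nat" where
  "color_rotation T col en c i =
     (if i \<in> {1..card (edges T)}
      then (THE j. j \<in> {1..card (edges T)} \<and>
              (\<exists>v. col v = c \<and> v \<in> en i \<and> v \<in> en j \<and> en j = ccw T v (en i)))
      else i)"

definition rotation_group ::
  "('v, 'm) plane_graph_scheme \<Rightarrow> ('v \<Rightarrow> color) \<Rightarrow> (nat \<Rightarrow> 'v set) \<Rightarrow> (nat \<Rightarrow> nat) set" where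
  "rotation_group T col en =
     generate (sym_group (card (edges T)))
       {color_rotation T col en White, color_rotation T col en Black}"

end

theory Submission
  imports Defs
begin

text \<open>
  An inversion in a bracket code is a pair of vertices neither of which is an ancestor of the
  other, so in a pr-tree with \<open>n\<close> vertices the number of inversions is \<open>n choose 2\<close> minus the sum of
  the depths. Modulo 2 this sum is the number of vertices whose colour differs from that of the
  root. For even \<open>n\<close> the two colour classes have the same parity, hence the parity of the tree is
  that of \<open>(n choose 2) + w\<close>, where \<open>w\<close> is the number of white vertices.

  On the other hand, the cycles of \<open>s\<^sub>w\<close> correspond to the white vertices and those of \<open>s\<^sub>b\<close> to the
  black ones. As the number \<open>n - 1\<close> of edges is odd, both permutations are even iff \<open>w\<close> is odd, and
  so \<open>n\<close> and the rotation group determine the parity of the tree.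
\<close>

section \<open>Sign of a permutation with given cycles\<close>

text \<open>Each recursive step of \<open>cycle_of_list\<close> splits off one transposition, so a
  cycle of length k is a product of k - 1 of them.\<close>

lemma evenperm_cycle_of_list:
  assumes "distinct cs" "cs \<noteq> []"
  shows "evenperm (cycle_of_list cs) \<longleftrightarrow> odd (length cs)"
  using assms
proof (induction cs rule: cycle_of_list.induct)
  case (1 i j cs)
  then show ?case
    by (simp add: evenperm_comp[OF permutation_swap_id permutation_of_cycle] evenperm_swap
        del: comp_apply)
qed auto

text \<open>Every point of \<open>A\<close> is reached again from itself by iterating
  \<open>f\<close>, so \<open>f\<close> maps \<open>A\<close> onto \<open>A\<close>; finiteness then
  gives injectivity.\<close>

lemma cyclic_on_perm_restrict_permutes:
  assumes "cyclic_on f A" "finite A"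
  shows "perm_restrict f A permutes A"
proof -
  have "f ` A = A"
  proof
    show "f ` A \<subseteq> A"
      using assms(1) by (auto intro: eq_on_cyclic_on_iff1)
    show "A \<subseteq> f ` A"
    proof
      fix y assume "y \<in> A"
      then have "y \<in> orbit f y"
        using assms(1) orbit_cyclic_eq3 by fastforce
      then obtain n where n: "0 < n" "y = (f ^^ n) y"
        by (auto simp: orbit_altdef)
      then obtain k where k: "n = Suc k" by (cases n) auto
      have "(f ^^ k) y \<in> A"
        using \<open>y \<in> A\<close> assms(1) by (induction k) (auto intro: eq_on_cyclic_on_iff1)
      with n k show "y \<in> f ` A" by auto
    qed
  qed
  then have "bij_betw f A A"
    using assms(2) by (simp add: bij_betw_def eq_card_imp_inj_on)
  then have "bij_betw (perm_restrict f A) A A"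
    by (subst bij_betw_cong[where g = f]) (auto simp: perm_restrict_simps)
  then show ?thesis
    by (intro bij_imp_permutes) (auto simp: perm_restrict_simps)
qed

text \<open>The restriction has \<open>A\<close> as a single orbit, so it is the cycle listed by
  \<open>support p x\<close> for any \<open>x\<close> in \<open>A\<close>.\<close>

lemma evenperm_cyclic_on:
  assumes "cyclic_on f A" "finite A"
  shows "evenperm (perm_restrict f A) \<longleftrightarrow> odd (card A)"
proof -
  define p where "p = perm_restrict f A"
  have p: "p permutes A" "permutation p"
    using cyclic_on_perm_restrict_permutes[OF assms] assms(2)
    by (auto simp: p_def permutation_permutes)
  obtain x where x: "x \<in> A" "A = orbit p x"
    using assms(1) unfolding p_def by (subst (asm) cyclic_on_perm_restrict[symmetric])
      (auto simp: cyclic_on_def)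
  have "set (support p x) = A"
  proof -
    have "set (support p x) \<subseteq> A"
      using p(1) x(1) by (auto simp: permutes_in_funpow_image)
    moreover have "A \<subseteq> range (\<lambda>i. (p ^^ i) x)"
      by (subst x(2)) (auto simp: orbit_altdef)
    ultimately show ?thesis
      using support_set[OF p(2), of x] by blast
  qed
  moreover have d: "distinct (support p x)" using cycle_of_permutation[OF p(2)] .
  moreover have "cycle_of_list (support p x) = p"
  proof
    fix y show "cycle_of_list (support p x) y = p y"
    proof (cases "y \<in> set (support p x)")
      case True
      then show ?thesis using cycle_restrict[OF p(2)] by auto
    next
      case False
      then show ?thesis
        using id_outside_supp[OF False] \<open>set (support p x) = A\<close> p(1) by (metis permutes_not_in)
    qed
  qed
  ultimately show ?thesis
    using evenperm_cycle_of_list[of "support p x"] x(1) distinct_card[OF d]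
    by (metis empty_iff p_def list.set(1))
qed

text \<open>The restriction of \<open>f\<close> to the union is a product of disjoint cycles, one
  for each index in \<open>W\<close>; each contributes its length minus 1 to the sign
  exponent.\<close>

lemma evenperm_cyclic_partition:
  assumes "finite W" "\<And>v. v \<in> W \<Longrightarrow> cyclic_on f (A v)" "\<And>v. v \<in> W \<Longrightarrow> finite (A v)"
    and "disjoint_family_on A W"
  shows "perm_restrict f (\<Union>(A ` W)) permutes \<Union>(A ` W) \<and>
    (evenperm (perm_restrict f (\<Union>(A ` W))) \<longleftrightarrow> even (card (\<Union>(A ` W)) + card W))"
  using assms
proof (induction W rule: finite_induct)
  case empty
  have "perm_restrict f {} = id" by (simp add: perm_restrict_def fun_eq_iff)
  then show ?case by (metis UN_empty add_0 card.empty even_zero evenperm_id permutes_id)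
next
  case (insert v W)
  let ?B = "\<Union>(A ` W)"
  have IH: "perm_restrict f ?B permutes ?B"
    "evenperm (perm_restrict f ?B) \<longleftrightarrow> even (card ?B + card W)"
    using insert by (auto simp: disjoint_family_on_def)
  have v: "perm_restrict f (A v) permutes A v"
    "evenperm (perm_restrict f (A v)) \<longleftrightarrow> odd (card (A v))"
    using insert.prems by (auto intro: cyclic_on_perm_restrict_permutes simp: evenperm_cyclic_on)
  have disj: "A v \<inter> ?B = {}"
    using insert.prems(3) insert.hyps(2) unfolding disjoint_family_on_def by fastforce
  have eq: "perm_restrict f (A v \<union> ?B) = perm_restrict f (A v) \<circ> perm_restrict f ?B"
    using perm_restrict_union[OF v(1) IH(1) disj] by simp
  have fin: "finite (A v)" "finite ?B"
    using insert by auto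
  have perm: "permutation (perm_restrict f (A v))" "permutation (perm_restrict f ?B)"
    using v(1) IH(1) fin by (auto simp: permutation_permutes)
  have "perm_restrict f (A v \<union> ?B) permutes (A v \<union> ?B)"
    unfolding eq by (rule permutes_compose) (use v(1) IH(1) permutes_subset in blast)+
  moreover have "evenperm (perm_restrict f (A v \<union> ?B)) \<longleftrightarrow> even (card (A v \<union> ?B) + card (insert v W))"
    unfolding eq using insert.hyps fin disj
    by (auto simp: evenperm_comp[OF perm] v(2) IH(2) card_Un_disjoint)
  ultimately show ?case by simp
qed

text \<open>Serves to carry the cyclic order \<open>ccw T v\<close> on edges over to the labels of
  the edges, with \<open>g\<close> inverse to the enumeration.\<close>

lemma cyclic_on_image:
  assumes "cyclic_on h B" "\<And>b. b \<in> B \<Longrightarrow> f (g b) = g (h b)"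
  shows "cyclic_on f (g ` B)"
proof -
  obtain s where s: "s \<in> B" "B = orbit h s"
    using assms(1) by (auto simp: cyclic_on_def)
  have comm: "f (g y) = g (h y)" if "y \<in> orbit h s" for y
    using assms(2) s(2) that by blast
  have "y \<in> g ` orbit h s" if "y \<in> orbit f (g s)" for y
    using that
  proof induction
    case base
    then show ?case using assms(2)[OF s(1)] by (auto intro: orbit.base)
  next
    case (step y)
    then show ?case by (auto simp: comm intro: orbit.step)
  qed
  moreover have "g y \<in> orbit f (g s)" if "y \<in> orbit h s" for y
    using that
  proof induction
    case base
    then show ?case using assms(2)[OF s(1)] by (metis orbit.base)
  next
    case (step y)
    then show ?case using comm by (metis orbit.step)
  qed
  ultimately have "orbit f (g s) = g ` B"
    using s(2) by blast
  then show ?thesis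
    using s(1) by (auto simp: cyclic_on_def)
qed

text \<open>The first return time of \<open>e\<close> equals the size of its orbit. Hence the
  iterates used in \<open>pr_tree_of\<close> and \<open>pr_branch\<close> list the edges at a vertex
  without repetition.\<close>

lemma cyclic_on_iterates:
  assumes "cyclic_on f S" "e \<in> S"
  shows "bij_betw (\<lambda>k. (f ^^ k) e) {0..<card S} S"
proof -
  have o: "orbit f e = S" using orbit_cyclic_eq3[OF assms] .
  then have e: "e \<in> orbit f e" using assms(2) by simp
  have "bij_betw (\<lambda>k. (f ^^ k) e) {0..<funpow_dist1 f e e} S"
    using inj_on_funpow_dist1[OF e] orbit_conv_funpow_dist1[OF e] o by (simp add: bij_betw_def)
  then show ?thesis using bij_betw_same_card by fastforce
qed


section \<open>Inversions and depths\<close>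

fun inv_count :: "bracket list \<Rightarrow> nat" where
  "inv_count [] = 0"
| "inv_count (x # xs) = (if x = Closing then count_list xs Opening else 0) + inv_count xs"

text \<open>An inversion of \<open>x # xs\<close> either lies in \<open>xs\<close>, shifted by one,
  or starts at position 0; the latter needs \<open>x = Closing\<close> and pairs it with every
  opening bracket of \<open>xs\<close>. Finiteness is carried along for the cardinality of the
  union.\<close>

lemma card_inversions: "finite (inversions w) \<and> card (inversions w) = inv_count w"
proof (induction w)
  case Nil
  then show ?case by (simp add: inversions_def)
next
  case (Cons x xs)
  let ?P = "{j. j < length xs \<and> x = Closing \<and> xs ! j = Opening}"
  have eq: "inversions (x # xs) = map_prod Suc Suc ` inversions xs \<union> (\<lambda>j. (0, Suc j)) ` ?P"
    (is "?L = ?R")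
  proof
    show "?L \<subseteq> ?R"
    proof
      fix p assume "p \<in> ?L"
      then obtain i j where p: "p = (i, Suc j)" "i < Suc j" "j < length xs"
        "(x # xs) ! i = Closing" "xs ! j = Opening"
        by (auto simp: inversions_def gr0_conv_Suc elim!: less_natE)
      then show "p \<in> ?R"
        by (cases i) (auto simp: inversions_def image_iff)
    qed
    show "?R \<subseteq> ?L" by (auto simp: inversions_def)
  qed
  have "card (map_prod Suc Suc ` inversions xs) = inv_count xs"
    using Cons by (subst card_image) (auto intro: inj_on_subset[OF prod.inj_map])
  moreover have "card ((\<lambda>j. (0::nat, Suc j)) ` ?P) = card ?P"
    by (rule card_image) (auto simp: inj_on_def)
  moreover have "card ?P = (if x = Closing then count_list xs Opening else 0)"
    by (auto simp: count_list_eq_length_filter length_filter_conv_card eq_commute)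
  ultimately show ?case
    unfolding eq using Cons by (subst card_Un_disjoint) auto
qed

lemma inv_count_append:
  "inv_count (xs @ ys) = inv_count xs + inv_count ys + count_list xs Closing * count_list ys Opening"
  by (induction xs) auto

text \<open>The number of vertices of even depth for \<open>b = True\<close>, and of odd depth for
  \<open>b = False\<close>. The flag flips because depths relative to a child are smaller by
  one.\<close>

fun level_count :: "bool \<Rightarrow> pr_tree \<Rightarrow> nat" where
  "level_count b (PR_Node ts) = of_bool b + sum_list (map (level_count (\<not> b)) ts)"

abbreviation node_count :: "pr_tree \<Rightarrow> nat" where
  "node_count t \<equiv> level_count True t + level_count False t"

text \<open>Each vertex contributes exactly one bracket of each kind.\<close>

lemma count_list_bracket_code: "count_list (bracket_code t) x = node_count t"
proof (induction t)
  case (PR_Node ts)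
  have "count_list (concat (map bracket_code ts)) x =
      sum_list (map (level_count True) ts) + sum_list (map (level_count False) ts)"
    using PR_Node by (induction ts) auto
  then show ?case by (cases x) auto
qed

lemma choose_two_add: "(a + b) choose 2 = (a choose 2) + (b choose 2) + a * b" for a b :: nat
  by (induction a) (auto simp: numeral_2_eq_2)

text \<open>This is the formula "inversions = \<open>n choose 2\<close> minus sum of depths" modulo
  2, where the sum of depths becomes the number of vertices of odd depth.\<close>

lemma even_inv_count:
  "even (inv_count (bracket_code t) + level_count False t + (node_count t choose 2))"
proof (induction t)
  case (PR_Node ts)
  let ?F = "concat (map bracket_code ts)"
  let ?s = "\<lambda>b. sum_list (map (level_count b) ts)"
  have "count_list ?F x = ?s True + ?s False" for x
    by (induction ts) (auto simp: count_list_bracket_code)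
  \<comment> \<open>The same claim for a forest, with depths measured from its roots. Joining
    \<open>t\<close> to the rest adds the product of the two sizes both to the inversions and to the
    binomial coefficient, so it cancels modulo 2.\<close>
  moreover have "even (inv_count ?F + ?s False + ((?s True + ?s False) choose 2))"
    using PR_Node
  proof (induction ts)
    case (Cons t ts)
    let ?s = "\<lambda>b. sum_list (map (level_count b) ts)"
    have c: "count_list (concat (map bracket_code ts)) Opening = ?s True + ?s False"
      by (induction ts) (auto simp: count_list_bracket_code)
    have "even (inv_count (concat (map bracket_code ts)) + ?s False + ((?s True + ?s False) choose 2))"
      "even (inv_count (bracket_code t) + level_count False t + (node_count t choose 2))"
      using Cons by auto
    moreover have "sum_list (map (level_count True) (t # ts)) + sum_list (map (level_count False) (t # ts))
        = node_count t + (?s True + ?s False)"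
      by simp
    ultimately show ?case
      unfolding \<open>sum_list (map (level_count True) (t # ts)) + _ = _\<close> choose_two_add
      by (simp add: inv_count_append count_list_bracket_code c) presburger
  qed (simp add: numeral_2_eq_2)
  \<comment> \<open>The outer brackets create no inversion. The new root exchanges even and odd
    depths, which is compensated modulo 2 by the growth of the binomial coefficient.\<close>
  moreover have "node_count (PR_Node ts) choose 2 = ((?s True + ?s False) choose 2) + (?s True + ?s False)"
    by (simp add: numeral_2_eq_2 add.commute)
  ultimately show ?case
    unfolding \<open>node_count (PR_Node ts) choose 2 = _\<close> by (simp add: inv_count_append) presburger
qed

corollary even_pr_tree_iff:
  "even_pr_tree t \<longleftrightarrow> even (level_count False t + (node_count t choose 2))"
  using even_inv_count[of t] card_inversions[of "bracket_code t"]
  by (auto simp: even_pr_tree_def)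


section \<open>Vertices of a plane tree by depth\<close>

definition adjacency_avoiding :: "'v set set \<Rightarrow> 'v \<Rightarrow> ('v \<times> 'v) set" where
  "adjacency_avoiding E w = {(x, y). {x, y} \<in> E \<and> x \<noteq> w \<and> y \<noteq> w}"

text \<open>In a tree, if \<open>u\<close> is a child of \<open>w\<close>, this is the vertex set of
  the subtree hanging at \<open>u\<close>.\<close>

definition component_avoiding :: "'v set set \<Rightarrow> 'v \<Rightarrow> 'v \<Rightarrow> 'v set" where
  "component_avoiding E w u = {x. (u, x) \<in> (adjacency_avoiding E w)\<^sup>*}"

lemma sym_adjacency_avoiding: "sym (adjacency_avoiding E w)"
  by (auto simp: sym_def adjacency_avoiding_def insert_commute)

lemma not_in_component_avoiding: "u \<noteq> w \<Longrightarrow> w \<notin> component_avoiding E w u"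
  by (auto simp: component_avoiding_def adjacency_avoiding_def elim: rtranclE)

text \<open>When a new starting point already occurs on the walk, the part before its occurrence is
  cut off. The last conjunct keeps track of reachability, so that a walk in
  \<open>adjacency_avoiding E w\<close> can be seen to miss \<open>w\<close>.\<close>

lemma rtrancl_distinct_walk:
  assumes "(a, b) \<in> R\<^sup>*"
  shows "\<exists>xs. xs \<noteq> [] \<and> hd xs = a \<and> last xs = b \<and> distinct xs \<and>
    successively (\<lambda>x y. (x, y) \<in> R) xs \<and> (\<forall>x \<in> set xs. (a, x) \<in> R\<^sup>*)"
  using assms
proof (induction rule: converse_rtrancl_induct)
  case base
  then show ?case by (intro exI[of _ "[b]"]) auto
next
  case (step a c)
  then obtain xs where xs: "xs \<noteq> []" "hd xs = c" "last xs = b" "distinct xs"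
    "successively (\<lambda>x y. (x, y) \<in> R) xs" "\<forall>x \<in> set xs. (c, x) \<in> R\<^sup>*"
    by blast
  have reach: "\<forall>x \<in> set xs. (a, x) \<in> R\<^sup>*"
    using xs(6) step(1) by (meson converse_rtrancl_into_rtrancl)
  show ?case
  proof (cases "a \<in> set xs")
    case True
    then obtain ys zs where "xs = ys @ a # zs" by (auto simp: in_set_conv_decomp)
    then show ?thesis
      using xs reach by (intro exI[of _ "a # zs"]) (auto simp: successively_append_iff)
  next
    case False
    then show ?thesis
      using xs reach step(1) by (intro exI[of _ "a # xs"]) (auto simp: successively_Cons)
  qed
qed

text \<open>A path from \<open>u\<close> to a different \<open>u'\<close> that avoids
  \<open>w\<close> would close up through \<open>w\<close> to a cycle.\<close>

lemma neighbours_separated: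
  assumes "\<nexists>vs. is_cycle E vs" "{w, u} \<in> E" "{w, u'} \<in> E" "u \<noteq> w"
    and "u' \<in> component_avoiding E w u"
  shows "u = u'"
proof (rule ccontr)
  assume "u \<noteq> u'"
  let ?R = "adjacency_avoiding E w"
  obtain xs where xs: "xs \<noteq> []" "hd xs = u" "last xs = u'" "distinct xs"
    "successively (\<lambda>x y. (x, y) \<in> ?R) xs" "\<forall>x \<in> set xs. (u, x) \<in> ?R\<^sup>*"
    using rtrancl_distinct_walk[of u u' ?R] assms(5) unfolding component_avoiding_def by auto
  have w: "w \<notin> set xs"
    using xs(6) not_in_component_avoiding[OF assms(4)] by (auto simp: component_avoiding_def)
  \<comment> \<open>The ends of \<open>xs\<close> differ, so \<open>w # xs\<close> has the three
    vertices that a cycle requires.\<close>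
  have "length xs \<ge> 2"
    using xs(1-3) \<open>u \<noteq> u'\<close> by (cases xs rule: remdups_adj.cases) auto
  moreover have "{(w # xs) ! i, (w # xs) ! (Suc i mod length (w # xs))} \<in> E"
    if i: "i < length (w # xs)" for i
  proof -
    consider "i = 0" | "i = length xs" | "0 < i" "i < length xs"
      using i by fastforce
    then show ?thesis
    proof cases
      case 1
      then show ?thesis using xs(1,2) assms(2) by (cases xs) auto
    next
      case 2
      then show ?thesis using xs(1,3) assms(3)
        by (auto simp: last_conv_nth nth_Cons' insert_commute)
    next
      case 3
      then obtain k where k: "i = Suc k" by (auto simp: gr0_conv_Suc)
      with 3 have "(xs ! k, xs ! Suc k) \<in> ?R"
        using xs(5) by (auto simp: successively_conv_nth)
      then show ?thesis using 3 k by (auto simp: adjacency_avoiding_def)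
    qed
  qed
  ultimately have "is_cycle E (w # xs)"
    using xs(4) w by (auto simp: is_cycle_def)
  with assms(1) show False by blast
qed

text \<open>The recursive structure of the rooted tree: the subtree at \<open>w\<close> with parent
  \<open>v\<close> is \<open>w\<close> together with the subtrees at the other neighbours of
  \<open>w\<close>.\<close>

lemma component_avoiding_decompose:
  assumes "\<nexists>vs. is_cycle E vs" "\<And>x. {x} \<notin> E" "{v, w} \<in> E"
  shows "component_avoiding E v w =
    insert w (\<Union>u \<in> {u. {w, u} \<in> E \<and> u \<noteq> v}. component_avoiding E w u)" (is "?L = ?R")
proof
  have vw: "v \<noteq> w" using assms(2,3) by auto
  show "?L \<subseteq> ?R"
  proof
    fix x assume "x \<in> ?L"
    then have "(w, x) \<in> (adjacency_avoiding E v)\<^sup>*" by (simp add: component_avoiding_def)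
    then show "x \<in> ?R"
    proof (induction rule: rtrancl_induct)
      case base
      then show ?case by simp
    next
      case (step y z)
      then have yz: "{y, z} \<in> E" "z \<noteq> v" by (auto simp: adjacency_avoiding_def)
      show ?case
      proof (cases "y = w")
        case True
        then show ?thesis using yz by (auto simp: component_avoiding_def)
      next
        case False
        then obtain u where u: "{w, u} \<in> E" "u \<noteq> v" "(u, y) \<in> (adjacency_avoiding E w)\<^sup>*"
          using step.IH by (auto simp: component_avoiding_def)
        show ?thesis
        proof (cases "z = w")
          case False
          then have "(y, z) \<in> adjacency_avoiding E w"
            using yz \<open>y \<noteq> w\<close> by (auto simp: adjacency_avoiding_def)
          then show ?thesis using u by (auto simp: component_avoiding_def)
        qed simp
      qed
    qed
  qed
  have "x \<in> ?L" if u: "{w, u} \<in> E" "u \<noteq> v" "x \<in> component_avoiding E w u" for x u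
  proof -
    have uw: "u \<noteq> w" using u(1) assms(2) by auto
    \<comment> \<open>Acyclicity enters here: both \<open>u\<close> and \<open>v\<close> are
      neighbours of \<open>w\<close>, so deleting \<open>w\<close> separates them, and a walk from
      \<open>u\<close> avoiding \<open>w\<close> also avoids \<open>v\<close>.\<close>
    have v: "v \<notin> component_avoiding E w u"
      using neighbours_separated[OF assms(1) u(1) _ uw, of v] u(2) assms(3)
      by (auto simp: insert_commute)
    have "(u, x) \<in> (adjacency_avoiding E w)\<^sup>*" using u(3) by (simp add: component_avoiding_def)
    then have "(w, x) \<in> (adjacency_avoiding E v)\<^sup>*"
    proof (induction rule: rtrancl_induct)
      case base
      then show ?case using u vw by (auto simp: adjacency_avoiding_def)
    next
      case (step y z)
      then have "y \<noteq> v" "z \<noteq> v"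
        using v by (auto simp: component_avoiding_def intro: rtrancl_into_rtrancl)
      with step have "(y, z) \<in> adjacency_avoiding E v" by (auto simp: adjacency_avoiding_def)
      with step.IH show ?case by (rule rtrancl_into_rtrancl)
    qed
    then show ?thesis by (simp add: component_avoiding_def)
  qed
  then show "?R \<subseteq> ?L" by (auto simp: component_avoiding_def)
qed

lemma component_avoiding_disjoint:
  assumes "\<nexists>vs. is_cycle E vs" "\<And>x. {x} \<notin> E" "{w, u} \<in> E" "{w, u'} \<in> E" "u \<noteq> u'"
  shows "component_avoiding E w u \<inter> component_avoiding E w u' = {}"
proof (rule ccontr)
  assume "\<not> ?thesis"
  then obtain x where "(u, x) \<in> (adjacency_avoiding E w)\<^sup>*" "(u', x) \<in> (adjacency_avoiding E w)\<^sup>*"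
    by (auto simp: component_avoiding_def)
  then have "u' \<in> component_avoiding E w u"
    using sym_rtrancl[OF sym_adjacency_avoiding, of E w]
    by (auto simp: component_avoiding_def dest: symD intro: rtrancl_trans)
  then show False
    using neighbours_separated[OF assms(1,3,4)] assms(2,3,5) by fastforce
qed

section \<open>Elementary facts on trees\<close>

lemma tree_no_loop: "is_tree V E \<Longrightarrow> {x} \<notin> E"
  by (auto simp: is_tree_def)

lemma tree_edge_verts: "is_tree V E \<Longrightarrow> {x, y} \<in> E \<Longrightarrow> x \<in> V \<and> y \<in> V"
  unfolding is_tree_def by (metis doubleton_eq_iff)

lemma tree_finite_edges: "is_tree V E \<Longrightarrow> finite E"
  by (rule finite_subset[of _ "Pow V"]) (auto simp: is_tree_def)

lemma incident_other_end:
  assumes "is_tree (verts T) (edges T)" "e \<in> incident T v"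
  shows "e = {v, other_end e v}" "other_end e v \<noteq> v"
proof -
  obtain x y where "x \<noteq> y" "e = {x, y}" "v = x \<or> v = y"
    using assms unfolding is_tree_def incident_def by blast
  then obtain u where u: "e = {v, u}" "u \<noteq> v" by blast
  then have "other_end e v = u" by (auto simp: other_end_def)
  with u show "e = {v, other_end e v}" "other_end e v \<noteq> v" by auto
qed

lemma component_avoiding_subset:
  assumes "is_tree V E" "u \<in> V"
  shows "component_avoiding E w u \<subseteq> V"
proof
  fix x assume "x \<in> component_avoiding E w u"
  then have "(u, x) \<in> (adjacency_avoiding E w)\<^sup>*" by (simp add: component_avoiding_def)
  then show "x \<in> V"
    by (induction rule: rtrancl_induct)
      (use assms(2) tree_edge_verts[OF assms(1)] in
        \<open>auto simp: adjacency_avoiding_def[of E w]\<close>)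
qed

text \<open>Colours alternate along edges, so the depth below \<open>v\<close> is even exactly at
  the vertices coloured like \<open>v\<close>. Allowing any distinct edges at \<open>v\<close> in
  \<open>es\<close> covers both the root, where all are listed, and the other vertices, where the
  parent edge is missing.\<close>

lemma level_count_pr_branch:
  assumes "plane_tree T" and col: "bipartite_structure T col"
    and "pr_branch T v es t" "v \<in> verts T" "distinct es" "set es \<subseteq> incident T v"
  shows "level_count b t = card {x \<in> insert v
    (\<Union>e \<in> set es. component_avoiding (edges T) v (other_end e v)). (col x = col v) = b}"
  using assms(3-6)
proof (induction arbitrary: b rule: pr_branch.induct)
  case (1 v es ts)
  let ?E = "edges T"
  let ?C = "\<lambda>e. component_avoiding ?E v (other_end e v)"
  have tree: "is_tree (verts T) ?E" using assms(1) by (simp add: plane_tree_def)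
  have acyc: "\<nexists>vs. is_cycle ?E vs" using tree by (simp add: is_tree_def)
  have e: "{v, other_end e v} \<in> ?E" "e = {v, other_end e v}" "other_end e v \<noteq> v"
    "other_end e v \<in> verts T" "e \<in> incident T (other_end e v)" if "e \<in> set es" for e
  proof -
    show e: "e = {v, other_end e v}" "other_end e v \<noteq> v"
      using incident_other_end[OF tree] that 1(4) by blast+
    have "e \<in> ?E" using that 1(4) by (auto simp: incident_def)
    with e show "{v, other_end e v} \<in> ?E" by simp
    then show "other_end e v \<in> verts T" using tree_edge_verts[OF tree] by blast
    show "e \<in> incident T (other_end e v)" using \<open>e \<in> ?E\<close> e by (auto simp: incident_def)
  qed
  have fin: "finite (?C e)" if "e \<in> set es" for e
    using component_avoiding_subset[OF tree e(4)[OF that]] tree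
    unfolding is_tree_def by (meson finite_subset)
  \<comment> \<open>The flag flips in passing to the child, and so does the reference colour; the
    condition relative to \<open>v\<close> is thus unchanged.\<close>
  have child: "level_count (\<not> b) t = card {x \<in> ?C e. (col x = col v) = b}"
    if "(e, t) \<in> set (zip es ts)" for e t
  proof -
    let ?w = "other_end e v"
    let ?es = "map (\<lambda>k. (ccw T ?w ^^ k) e) [1..<deg T ?w]"
    have es: "e \<in> set es" using that by (rule set_zip_leftD)
    note e = e[OF es]
    have "cyclic_on (ccw T ?w) (incident T ?w)"
      using assms(1) e(4,5) by (auto simp: plane_tree_def)
    then have bij: "bij_betw (\<lambda>k. (ccw T ?w ^^ k) e) {0..<deg T ?w} (incident T ?w)"
      using cyclic_on_iterates[OF _ e(5)] by (simp add: deg_def)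
    have "finite (incident T ?w)" using tree_finite_edges[OF tree] by (simp add: incident_def)
    then have "deg T ?w > 0" using e(5) by (auto simp: deg_def card_gt_0_iff)
    \<comment> \<open>Exponent 0 yields the parent edge \<open>e\<close>; splitting it off shows
      that \<open>?es\<close> lists precisely the remaining edges at the child.\<close>
    then have ivl: "{0..<deg T ?w} = insert 0 {1..<deg T ?w}" by auto
    have d: "distinct ?es"
      using bij unfolding ivl by (auto simp: distinct_map bij_betw_def)
    have "set ?es = incident T ?w - {e}"
      using bij unfolding ivl by (auto simp: bij_betw_def)
    have "\<Union>((\<lambda>f. component_avoiding ?E ?w (other_end f ?w)) ` (incident T ?w - {e})) =
      \<Union>(component_avoiding ?E ?w ` {u. {?w, u} \<in> ?E \<and> u \<noteq> v})"
    proof -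
      have "(\<lambda>f. other_end f ?w) ` (incident T ?w - {e}) = {u. {?w, u} \<in> ?E \<and> u \<noteq> v}"
      proof (intro equalityI subsetI)
        fix u assume "u \<in> (\<lambda>f. other_end f ?w) ` (incident T ?w - {e})"
        then obtain f where f: "f \<in> incident T ?w" "f \<noteq> e" "u = other_end f ?w" by blast
        then have "f = {?w, u}" using incident_other_end[OF tree] by blast
        moreover have "u \<noteq> v" using \<open>f = _\<close> f(2) e(2) by (metis insert_commute)
        ultimately show "u \<in> {u. {?w, u} \<in> ?E \<and> u \<noteq> v}" using f(1) by (auto simp: incident_def)
      next
        fix u assume u: "u \<in> {u. {?w, u} \<in> ?E \<and> u \<noteq> v}"
        then have f: "{?w, u} \<in> incident T ?w" by (auto simp: incident_def)
        have "u = other_end {?w, u} ?w"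
          using incident_other_end[OF tree f] by (metis doubleton_eq_iff)
        moreover have "{?w, u} \<noteq> e" using u e(2,3) by (metis (mono_tags, lifting) doubleton_eq_iff mem_Collect_eq)
        ultimately show "u \<in> (\<lambda>f. other_end f ?w) ` (incident T ?w - {e})" using f by blast
      qed
      from this[symmetric] show ?thesis by (simp only: image_image)
    qed
    then have S: "insert ?w (\<Union>f \<in> set ?es. component_avoiding ?E ?w (other_end f ?w)) = ?C e"
      using component_avoiding_decompose[OF acyc tree_no_loop[OF tree] e(1)] \<open>set ?es = _\<close> by simp
    have "col ?w \<noteq> col v" using col e(1) by (force simp: bipartite_structure_def)
    then have "(col x = col ?w) = (\<not> b) \<longleftrightarrow> (col x = col v) = b" for x
      by (cases "col x"; cases "col ?w"; cases "col v") auto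
    moreover have "level_count (\<not> b) t = card {x \<in> ?C e. (col x = col ?w) = (\<not> b)}"
    proof -
      have "set ?es \<subseteq> incident T ?w" using \<open>set ?es = _\<close> by blast
      moreover have "?w \<in> verts T \<longrightarrow> distinct ?es \<longrightarrow> set ?es \<subseteq> incident T ?w \<longrightarrow>
        level_count (\<not> b) t = card {x \<in> insert ?w
          (\<Union>f \<in> set ?es. component_avoiding ?E ?w (other_end f ?w)). (col x = col ?w) = (\<not> b)}"
        using 1(1) that by (auto simp only: list_all2_iff)
      ultimately show ?thesis using e(4) d unfolding S by blast
    qed
    ultimately show ?thesis by simp
  qed
  have len: "length es = length ts" using 1(1) by (rule list_all2_lengthD)
  have "map (level_count (\<not> b)) ts = map (\<lambda>e. card {x \<in> ?C e. (col x = col v) = b}) es"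
    using child len by (intro nth_equalityI) (auto simp: set_zip)
  then have "level_count b (PR_Node ts) = of_bool b + (\<Sum>e \<in> set es. card {x \<in> ?C e. (col x = col v) = b})"
    using 1(3) by (simp add: sum_list_distinct_conv_sum_set)
  \<comment> \<open>Distinct edges at \<open>v\<close> lead to distinct neighbours, whose components
    are disjoint.\<close>
  also have "(\<Sum>e \<in> set es. card {x \<in> ?C e. (col x = col v) = b}) =
      card (\<Union>e \<in> set es. {x \<in> ?C e. (col x = col v) = b})"
  proof (rule card_UN_disjoint[symmetric])
    show "\<forall>e\<in>set es. \<forall>f\<in>set es. e \<noteq> f \<longrightarrow>
       {x \<in> ?C e. (col x = col v) = b} \<inter> {x \<in> ?C f. (col x = col v) = b} = {}"
    proof (intro ballI impI)
      fix e' f assume ef: "e' \<in> set es" "f \<in> set es" "e' \<noteq> f"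
      then have "other_end e' v \<noteq> other_end f v" using e(2) by metis
      then have "?C e' \<inter> ?C f = {}"
        using component_avoiding_disjoint[OF acyc tree_no_loop[OF tree]] e(1) ef by blast
      then show "{x \<in> ?C e'. (col x = col v) = b} \<inter> {x \<in> ?C f. (col x = col v) = b} = {}" by blast
    qed
  qed (use fin in auto)
  also have "of_bool b + \<dots> = card {x \<in> insert v (\<Union>e \<in> set es. ?C e). (col x = col v) = b}"
  proof -
    let ?U = "\<Union>e \<in> set es. {x \<in> ?C e. (col x = col v) = b}"
    have "v \<notin> ?U" using e(3) not_in_component_avoiding by fastforce
    moreover have "finite ?U" using fin by auto
    moreover have "{x \<in> insert v (\<Union>e \<in> set es. ?C e). (col x = col v) = b} =
      (if b then insert v ?U else ?U)" by auto
    ultimately show ?thesis by auto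
  qed
  finally show ?case .
qed

text \<open>At the root all incident edges are listed, and by connectedness the components behind
  them exhaust the remaining vertices.\<close>

lemma level_count_pr_tree_of:
  assumes "plane_tree T" "bipartite_structure T col" "pr_tree_of T r e t"
  shows "level_count b t = card {x \<in> verts T. (col x = col r) = b}"
proof -
  let ?E = "edges T"
  let ?es = "map (\<lambda>k. (ccw T r ^^ k) e) [0..<deg T r]"
  have r: "r \<in> verts T" "e \<in> incident T r" "pr_branch T r ?es t"
    using assms(3) by (auto simp: pr_tree_of_def)
  have tree: "is_tree (verts T) ?E" using assms(1) by (simp add: plane_tree_def)
  have "cyclic_on (ccw T r) (incident T r)"
    using assms(1) r by (auto simp: plane_tree_def)
  then have bij: "bij_betw (\<lambda>k. (ccw T r ^^ k) e) {0..<deg T r} (incident T r)"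
    using cyclic_on_iterates[OF _ r(2)] by (simp add: deg_def)
  have es: "distinct ?es" "set ?es = incident T r"
    using bij by (auto simp: distinct_map bij_betw_def)
  let ?S = "insert r (\<Union>e \<in> set ?es. component_avoiding ?E r (other_end e r))"
  have "?S \<subseteq> verts T"
  proof -
    have "other_end f r \<in> verts T" if "f \<in> incident T r" for f
      using incident_other_end(1)[OF tree that] that tree_edge_verts[OF tree]
      by (metis (mono_tags, lifting) incident_def mem_Collect_eq)
    then show ?thesis
      unfolding es(2) using component_avoiding_subset[OF tree] r(1) by blast
  qed
  moreover have "x \<in> ?S" if "x \<in> verts T" for x
  proof -
    have "(r, x) \<in> {(x, y). {x, y} \<in> ?E}\<^sup>*" using tree r(1) that by (auto simp: is_tree_def)
    then show ?thesis
    proof (induction rule: rtrancl_induct)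
      case base
      then show ?case by simp
    next
      case (step y z)
      then have yz: "{y, z} \<in> ?E" by simp
      show ?case
      \<comment> \<open>Along a walk from \<open>r\<close>, a step leaving \<open>r\<close> enters
        the component of a neighbour, and a step that does not touch \<open>r\<close> stays in its
        component.\<close>
      proof (cases "y = r \<or> z = r")
        case True
        moreover have "z \<in> ?S" if "y = r"
        proof -
          have f: "{r, z} \<in> incident T r" using yz that by (auto simp: incident_def)
          then have "other_end {r, z} r = z"
            using incident_other_end[OF tree f] by (metis doubleton_eq_iff)
          then have "z \<in> component_avoiding ?E r (other_end {r, z} r)"
            by (simp add: component_avoiding_def)
          then show ?thesis using f es(2) by blast
        qed
        ultimately show ?thesis by auto
      next
        case False
        then obtain f where "f \<in> set ?es" "(other_end f r, y) \<in> (adjacency_avoiding ?E r)\<^sup>*"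
          using step.IH by (auto simp: component_avoiding_def)
        moreover have "(y, z) \<in> adjacency_avoiding ?E r"
          using False yz by (auto simp: adjacency_avoiding_def)
        ultimately have "z \<in> component_avoiding ?E r (other_end f r)"
          by (auto simp: component_avoiding_def intro: rtrancl_into_rtrancl)
        then show ?thesis using \<open>f \<in> set ?es\<close> by blast
      qed
    qed
  qed
  ultimately have "?S = verts T" by blast
  then show ?thesis
    using level_count_pr_branch[OF assms(1,2) r(3,1) es(1), of b] es(2) by simp
qed


section \<open>Sign of the rotations\<close>

text \<open>Excludes the one-vertex tree, whose vertex gives no cycle of a rotation.\<close>

lemma tree_incident_nonempty:
  assumes "is_tree (verts T) (edges T)" "2 \<le> card (verts T)" "v \<in> verts T"
  shows "incident T v \<noteq> {}"
proof -
  obtain u where u: "u \<in> verts T" "u \<noteq> v"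
    using assms(2) by (metis One_nat_def card_1_singleton_iff card_le_Suc0_iff_eq
        not_less_eq_eq numeral_2_eq_2 card.infinite zero_le assms(3))
  then have "(v, u) \<in> {(x, y). {x, y} \<in> edges T}\<^sup>*"
    using assms(1,3) by (auto simp: is_tree_def)
  then obtain x where "{v, x} \<in> edges T"
    using u(2) by (auto elim: converse_rtranclE)
  then show ?thesis by (auto simp: incident_def)
qed

text \<open>Even permutations are closed under products and inverses. The induction also carries
  \<open>permutes\<close>, since the sign is multiplicative only on permutations of finite
  support.\<close>

lemma rotation_group_evenperm:
  assumes "\<And>c. color_rotation T col en c permutes {1..card (edges T)}"
    and "\<And>c. evenperm (color_rotation T col en c)"
  shows "rotation_group T col en \<subseteq> {p. evenperm p}"
proof -
  let ?G = "sym_group (card (edges T))"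
  have "p permutes {1..card (edges T)} \<and> evenperm p" if "p \<in> rotation_group T col en" for p
    using that unfolding rotation_group_def
  proof induction
    case one
    show ?case unfolding sym_group_one using permutes_id evenperm_id by blast
  next
    case (incl h)
    then show ?case using assms by auto
  next
    case (inv h)
    then have "h permutes {1..card (edges T)}" "evenperm h" using assms by auto
    then show ?case
      by (simp add: sym_group_carrier permutes_inv
          evenperm_inv[OF permutes_imp_permutation[OF finite_atLeastAtMost]])
  next
    case (eng h1 h2)
    then show ?case
      unfolding sym_group_mult
      by (metis evenperm_comp finite_atLeastAtMost permutes_compose permutes_imp_permutation)
  qed
  then show ?thesis by auto
qed

text \<open>On the labels of the edges at \<open>v\<close>, the rotation is \<open>ccw T v\<close>
  conjugated by the enumeration.\<close>

lemma color_rotation_cyclic_on: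
  assumes tree: "plane_tree T" and col: "bipartite_structure T col"
    and en: "bij_betw en {1..card (edges T)} (edges T)"
    and v: "v \<in> verts T" "col v = c" "incident T v \<noteq> {}"
  shows "cyclic_on (color_rotation T col en c) {i \<in> {1..card (edges T)}. v \<in> en i}"
proof -
  let ?M = "{1..card (edges T)}" and ?f = "color_rotation T col en c"
  define g where "g = inv_into ?M en"
  have g: "g e \<in> ?M" "en (g e) = e" if "e \<in> edges T" for e
    using bij_betw_apply[OF bij_betw_inv_into[OF en] that] bij_betw_inv_into_right[OF en that]
    by (simp_all add: g_def)
  have en_g: "g (en i) = i" "en i \<in> edges T" if "i \<in> ?M" for i
    using bij_betw_apply[OF en that] bij_betw_inv_into_left[OF en that] by (simp_all add: g_def)
  have cyc: "cyclic_on (ccw T v) (incident T v)"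
    using tree v by (simp add: plane_tree_def)
  have "?f (g e) = g (ccw T v e)" if "e \<in> incident T v" for e
  proof -
    have e: "e \<in> edges T" "v \<in> e" using that by (auto simp: incident_def)
    have "ccw T v e \<in> incident T v" using eq_on_cyclic_on_iff1[OF cyc that] by blast
    then have e': "ccw T v e \<in> edges T" "v \<in> ccw T v e" by (auto simp: incident_def)
    \<comment> \<open>The ends of \<open>e\<close> have different colours, so the existential in
      \<open>color_rotation\<close> can only be witnessed by \<open>v\<close>, and the description
      is unique.\<close>
    have unique: "v' = v" if "col v' = c" "v' \<in> e" for v'
    proof (rule ccontr)
      assume "v' \<noteq> v"
      then have "e = {v', v}"
        using incident_other_end(1)[OF _ \<open>e \<in> incident T v\<close>] tree that(2) unfolding plane_tree_def
        by blast
      then show False using col e(1) that(1) v(2) unfolding bipartite_structure_def by metis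
    qed
    have "(THE j. j \<in> ?M \<and> (\<exists>v. col v = c \<and> v \<in> e \<and> v \<in> en j \<and> en j = ccw T v e)) = g (ccw T v e)"
    proof (rule the_equality)
      show "g (ccw T v e) \<in> ?M \<and> (\<exists>v'. col v' = c \<and> v' \<in> e \<and> v' \<in> en (g (ccw T v e)) \<and>
          en (g (ccw T v e)) = ccw T v' e)"
        using g[OF e'(1)] e e' v(2) by auto
    next
      fix j assume j: "j \<in> ?M \<and> (\<exists>v'. col v' = c \<and> v' \<in> e \<and> v' \<in> en j \<and> en j = ccw T v' e)"
      then have "en j = ccw T v e" using unique by blast
      with en_g(1)[of j] j show "j = g (ccw T v e)" by metis
    qed
    then show ?thesis using g[OF e(1)] by (simp add: color_rotation_def)
  qed
  then have "cyclic_on ?f (g ` incident T v)"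
    by (rule cyclic_on_image[OF cyc])
  also have "g ` incident T v = {i \<in> ?M. v \<in> en i}"
  proof (intro equalityI subsetI)
    fix i assume "i \<in> {i \<in> ?M. v \<in> en i}"
    then show "i \<in> g ` incident T v"
      using en_g[of i] by (intro image_eqI[of _ _ "en i"]) (auto simp: incident_def)
  qed (use g in \<open>auto simp: incident_def\<close>)
  finally show ?thesis .
qed

text \<open>Every edge has exactly one end of colour \<open>c\<close>, so the label sets at the
  vertices of that colour partition all labels into the cycles of the rotation.\<close>

lemma evenperm_color_rotation:
  assumes tree: "plane_tree T" and col: "bipartite_structure T col"
    and en: "bij_betw en {1..card (edges T)} (edges T)" and "2 \<le> card (verts T)"
  shows "color_rotation T col en c permutes {1..card (edges T)}"
    and "evenperm (color_rotation T col en c) \<longleftrightarrow>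
      even (card (edges T) + card {v \<in> verts T. col v = c})"
proof -
  let ?M = "{1..card (edges T)}" and ?f = "color_rotation T col en c"
    and ?W = "{v \<in> verts T. col v = c}"
  define A where "A v = {i \<in> ?M. v \<in> en i}" for v
  have T: "is_tree (verts T) (edges T)" using tree by (simp add: plane_tree_def)
  have endpoints: "\<exists>x y. en i = {x, y} \<and> x \<in> verts T \<and> y \<in> verts T \<and> col x \<noteq> col y" if "i \<in> ?M" for i
  proof -
    have "en i \<in> edges T" using en that by (auto simp: bij_betw_def)
    moreover from this obtain x y where "en i = {x, y}" "x \<in> verts T" "y \<in> verts T"
      using T unfolding is_tree_def by blast
    ultimately show ?thesis using col by (metis bipartite_structure_def)
  qed
  have "\<Union>(A ` ?W) = ?M"
  proof (intro equalityI subsetI)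
    fix i assume i: "i \<in> ?M"
    obtain x y where xy: "en i = {x, y}" "x \<in> verts T" "y \<in> verts T" "col x \<noteq> col y"
      using endpoints[OF i] by blast
    then have "col x = c \<or> col y = c" by (cases "col x"; cases "col y"; cases c) auto
    with xy i show "i \<in> \<Union>(A ` ?W)" by (auto simp: A_def)
  qed (auto simp: A_def)
  moreover have "disjoint_family_on A ?W"
    using endpoints by (fastforce simp: disjoint_family_on_def A_def)
  moreover have "cyclic_on ?f (A v)" if "v \<in> ?W" for v
    using that color_rotation_cyclic_on[OF tree col en] tree_incident_nonempty[OF T assms(4)]
    by (simp add: A_def)
  moreover have "finite ?W" using T by (simp add: is_tree_def)
  moreover have "finite (A v)" for v by (simp add: A_def)
  moreover have "perm_restrict ?f ?M = ?f"
    by (auto simp: perm_restrict_def color_rotation_def fun_eq_iff)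
  ultimately show "?f permutes ?M" "evenperm ?f \<longleftrightarrow> even (card (edges T) + card ?W)"
    using evenperm_cyclic_partition[of ?W ?f A] by auto
qed

section \<open>Both parities through the number of white vertices\<close>

lemma card_color_classes:
  assumes "finite V"
  shows "card {v \<in> V. col v = White} + card {v \<in> V. col v \<noteq> White} = card V"
  using assms by (subst card_Un_disjoint[symmetric]) (auto intro: arg_cong[of _ _ card])

text \<open>The left side depends on the group alone, so the parity of the number of white vertices
  can be recovered from it.\<close>

lemma rotation_group_even_iff:
  assumes tree: "plane_tree T" and n: "card (verts T) = n" "even n" "0 < n"
    and col: "bipartite_structure T col" and en: "bij_betw en {1..n - 1} (edges T)"
  shows "rotation_group T col en \<subseteq> {p. evenperm p} \<longleftrightarrow> odd (card {v \<in> verts T. col v = White})"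
proof -
  have m: "card (edges T) = n - 1" using bij_betw_same_card[OF en] by simp
  have "2 \<le> n" using n by presburger
  note rot = evenperm_color_rotation[OF tree col, of en, unfolded m n(1), OF en this]
  let ?w = "\<lambda>c. card {v \<in> verts T. col v = c}"
  have "odd (n - 1)" using n(2,3) by simp
  then have ev: "evenperm (color_rotation T col en c) \<longleftrightarrow> odd (?w c)" for c
    using rot(2)[of c] by simp
  have "col v = Black \<longleftrightarrow> col v \<noteq> White" for v by (cases "col v") auto
  then have "{v \<in> verts T. col v = Black} = {v \<in> verts T. col v \<noteq> White}" by simp
  moreover have "finite (verts T)" using n(1,3) card_ge_0_finite by blast
  ultimately have "?w White + ?w Black = n"
    using card_color_classes[of "verts T" col] n(1) by simp
  \<comment> \<open>As \<open>n\<close> is even, the two generators have the same sign.\<close>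
  then have "even (?w Black) = even (?w White)" using n(2) by presburger
  then have "odd (?w c) \<longleftrightarrow> odd (?w White)" for c by (cases c) auto
  with ev have "evenperm (color_rotation T col en c) \<longleftrightarrow> odd (?w White)" for c by blast
  then show ?thesis
    using rotation_group_evenperm[of T col en] rot(1) m
    by (auto simp: rotation_group_def intro: generate.incl)
qed

lemma even_pr_tree_iff_color_class:
  assumes tree: "plane_tree T" and n: "card (verts T) = n" "even n"
    and col: "bipartite_structure T col" and t: "pr_tree_of T r e t"
  shows "even_pr_tree t \<longleftrightarrow> even (card {v \<in> verts T. col v = White} + (n choose 2))"
proof -
  let ?w = "card {v \<in> verts T. col v = White}"
  have fin: "finite (verts T)" using tree by (simp add: plane_tree_def is_tree_def)
  note level = level_count_pr_tree_of[OF tree col t]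
  have "node_count t = n"
    unfolding level n(1)[symmetric]
    using fin by (subst card_Un_disjoint[symmetric]) (auto intro: arg_cong[of _ _ card])
  moreover have "even (level_count False t) = even ?w"
  \<comment> \<open>The vertices of odd depth are the black ones for a white root and the white ones
    for a black root; for even \<open>n\<close> both numbers have the same parity.\<close>
  proof (cases "col r")
    case White
    then show ?thesis
      using level[of False] card_color_classes[OF fin, of col] n by (simp; metis even_add)
  next
    case Black
    then have "col x \<noteq> col r \<longleftrightarrow> col x = White" for x by (cases "col x") auto
    then show ?thesis using level[of False] by simp
  qed
  ultimately show ?thesis by (simp add: even_pr_tree_iff)
qed

theorem proposition5p1:
  fixes n :: nat and T :: "'a plane_graph" and U :: "'b plane_graph"
    and colT :: "'a \<Rightarrow> color" and colU :: "'b \<Rightarrow> color"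
    and enT :: "nat \<Rightarrow> 'a set" and enU :: "nat \<Rightarrow> 'b set"
  assumes "even n" and "0 < n"
    and "even_plane_tree T" and "card (verts T) = n"
    and "odd_plane_tree U" and "card (verts U) = n"
    and "bipartite_structure T colT" and "bipartite_structure U colU"
    and "bij_betw enT {1..n - 1} (edges T)" and "bij_betw enU {1..n - 1} (edges U)"
  shows "rotation_group T colT enT \<noteq> rotation_group U colU enU"
proof -
  have T: "plane_tree T" "even (card {v \<in> verts T. colT v = White} + (n choose 2))"
    using assms(3) even_pr_tree_iff_color_class[OF _ assms(4,1,7)]
    by (auto simp: even_plane_tree_def)
  have U: "plane_tree U" "odd (card {v \<in> verts U. colU v = White} + (n choose 2))"
    using assms(5) even_pr_tree_iff_color_class[OF _ assms(6,1,8)]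
    by (auto simp: odd_plane_tree_def)
  \<comment> \<open>The numbers of white vertices of \<open>T\<close> and \<open>U\<close> have
    opposite parities, so exactly one of the two groups consists of even permutations.\<close>
  show ?thesis
    using rotation_group_even_iff[OF T(1) assms(4,1,2,7,9)]
      rotation_group_even_iff[OF U(1) assms(6,1,2,8,10)] T(2) U(2)
    by auto
qed

end
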